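(* Let $f(x)\in\mathbb{Q}[x]$ be a non-constant polynomial. If $\deg f$ is odd, then $f$ satisfies WP. If $\deg f$ is even, then $f(\mathbb{Q})$ is a positive base if the leading coefficient of $f$ is positive, and a negative base if the leading coefficient of $f$ is negative.
   Context: For $X\subseteq\mathbb{Q}$ and a positive integer $N$, write $X_N:=\{x_1+\cdots+x_N : x_1,\dots,x_N\in X\}$. $X$ is called a base if $X_N=\mathbb{Q}$ for some $N\ge 1$; a positive base if for some $N\ge1$ and some $a\in\mathbb{Q}$, $X_N\supseteq (a,\infty)\cap\mathbb{Q}$; a negative base if for some $N\ge 1$ and some $b\in\mathbb{Q}$, $X_N\supseteq(-\infty,b)\cap\mathbb{Q}$. $f(\mathbb{Q})=\{f(a):a\in\mathbb{Q}\}$, and $f$ satisfies WP if $f(\mathbb{Q})$ is a base. *)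

theory Defs
  imports "HOL-Computational_Algebra.Polynomial"
begin

definition sumset :: "rat set \<Rightarrow> nat \<Rightarrow> rat set" where
  "sumset X N = {s. \<exists>x :: nat \<Rightarrow> rat. (\<forall>i<N. x i \<in> X) \<and> s = (\<Sum>i<N. x i)}"

definition is_base :: "rat set \<Rightarrow> bool" where
  "is_base X \<longleftrightarrow> (\<exists>N\<ge>1. sumset X N = UNIV)"

definition is_positive_base :: "rat set \<Rightarrow> bool" where
  "is_positive_base X \<longleftrightarrow> (\<exists>N\<ge>1. \<exists>a::rat. {a<..} \<subseteq> sumset X N)"

definition is_negative_base :: "rat set \<Rightarrow> bool" where
  "is_negative_base X \<longleftrightarrow> (\<exists>N\<ge>1. \<exists>b::rat. {..<b} \<subseteq> sumset X N)"

definition WP :: "rat poly \<Rightarrow> bool" where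
  "WP f \<longleftrightarrow> is_base (range (poly f))"

end

theory Submission
  imports Complex_Main "HOL-Number_Theory.Cong" Defs
begin

text \<open>
  Write $f_a = e^{a D^2/2} f$ for the heat flow of $f$, that is, the mean of $f(y + Z)$ for a centred
  normal variable $Z$ of variance $a$. Perturbing Gauss-Hermite quadrature gives rational nodes
  $b_i$ and positive rational weights $w_i$ with the moments of the standard normal distribution up
  to the order $\deg f + 1$, so that $\sum_i w_i f_a(y + x b_i) = f_{a + x^2}(y)$. Tilting the
  weights to $w_i (1 + \varepsilon b_i)$ adds $\varepsilon x f_{a+x^2}'(y)$ by Stein's identity.
  For rational $|t| \le 1$ write $1 - t^2$ as a sum of four rational squares. Four plain averages
  and a tilted one then represent
  $f_1(y) + \varepsilon t f_1'(y)$ as a positive combination of values of $f$ whose coefficients do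
  not depend on $t$. After clearing denominators, a fixed number of values of $f$ represents every
  rational of some interval, and adding one more value of $f$, which can be placed in any prescribed
  interval in the range of $f$ over the reals, reaches all rationals claimed.
\<close>

subsection \<open>Sumsets with weights\<close>

lemma sumset_Suc:
  "s \<in> sumset X (Suc N) \<longleftrightarrow> (\<exists>t\<in>sumset X N. \<exists>x\<in>X. s = t + x)"
proof
  assume "s \<in> sumset X (Suc N)"
  then obtain x where x: "\<forall>i<Suc N. x i \<in> X" "s = (\<Sum>i<Suc N. x i)"
    unfolding sumset_def by blast
  then have "\<forall>i<N. x i \<in> X" by simp
  then have "(\<Sum>i<N. x i) \<in> sumset X N" unfolding sumset_def by blast
  then show "\<exists>t\<in>sumset X N. \<exists>x\<in>X. s = t + x" using x by auto
next
  assume "\<exists>t\<in>sumset X N. \<exists>x\<in>X. s = t + x"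
  then obtain x z where x: "\<forall>i<N. x i \<in> X" and z: "z \<in> X" and s: "s = (\<Sum>i<N. x i) + z"
    unfolding sumset_def by blast
  have "s = (\<Sum>i<Suc N. if i < N then x i else z)" unfolding s by simp
  then show "s \<in> sumset X (Suc N)"
    unfolding sumset_def mem_Collect_eq using x z
    by (intro exI[of _ "\<lambda>i. if i < N then x i else z"]) simp
qed

lemma sumset_0: "sumset X 0 = {0}"
  by (simp add: sumset_def)

lemma sumset_1: "sumset X 1 = X"
  using sumset_Suc[of _ X 0] by (auto simp: sumset_0)

lemma sumset_add:
  assumes "s \<in> sumset X M" "t \<in> sumset X N"
  shows "s + t \<in> sumset X (M + N)"
  using assms(2)
proof (induction N arbitrary: t)
  case 0
  then show ?case using assms(1) by (simp add: sumset_0)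
next
  case (Suc N)
  then obtain u x where "u \<in> sumset X N" "x \<in> X" "t = u + x"
    by (auto simp: sumset_Suc)
  then show ?case using Suc.IH[of u] by (auto simp: sumset_Suc add.assoc[symmetric])
qed

lemma sumset_of_nat_mult:
  "s \<in> sumset X M \<Longrightarrow> of_nat k * s \<in> sumset X (k * M)"
proof (induction k)
  case (Suc k)
  then show ?case using sumset_add[of s X M "of_nat k * s" "k * M"] by (simp add: algebra_simps)
qed (simp add: sumset_0)

lemma sumset_sum:
  assumes "finite A" "\<And>i. i \<in> A \<Longrightarrow> v i \<in> sumset X M"
  shows "(\<Sum>i\<in>A. of_nat (m i) * v i) \<in> sumset X ((\<Sum>i\<in>A. m i) * M)"
  using assms
proof (induction A rule: finite_induct)
  case (insert i A)
  then have "of_nat (m i) * v i + (\<Sum>i\<in>A. of_nat (m i) * v i)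
      \<in> sumset X (m i * M + (\<Sum>i\<in>A. m i) * M)"
    by (intro sumset_add sumset_of_nat_mult) simp_all
  then show ?case using insert.hyps by (simp add: distrib_right)
qed (simp add: sumset_0)

lemma common_denominator:
  fixes w :: "'i \<Rightarrow> rat"
  assumes "finite A" "\<And>i. i \<in> A \<Longrightarrow> w i \<ge> 0"
  shows "\<exists>c>0. \<exists>m. \<forall>i\<in>A. of_nat c * w i = of_nat (m i)"
  using assms
proof (induction A rule: finite_induct)
  case (insert i A)
  then obtain c m where c: "c > 0" "\<forall>i\<in>A. of_nat c * w i = of_nat (m i)" by auto
  obtain a b where q: "quotient_of (w i) = (a, b)" by (cases "quotient_of (w i)")
  then have b: "b > 0" and wi: "w i = of_int a / of_int b"
    by (auto simp: quotient_of_denom_pos quotient_of_div)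
  then have "a \<ge> 0" using insert.prems[of i] by (simp add: zero_le_divide_iff)
  then have k: "of_nat (nat b) * w i = of_nat (nat a)" using b wi by simp
  have "of_nat (c * nat b) * w j = of_nat (if j = i then c * nat a else nat b * m j)"
    if "j \<in> insert i A" for j
    using k c that by (auto simp: mult.assoc mult.left_commute[of "of_nat (nat b)"] simp del: of_nat_nat)
  moreover have "c * nat b > 0" using b c by simp
  ultimately show ?case
    by (intro exI[of _ "c * nat b"] conjI exI[of _ "\<lambda>j. if j = i then c * nat a else nat b * m j"]) auto
qed auto

text \<open>A natural multiple of a value is a repeated summand, so clearing denominators turns a
  nonnegative combination into a plain sum. \<open>c\<close> and \<open>N\<close> are fixed before
  \<open>M\<close> and \<open>v\<close>, which makes the number of summands uniform in the values;
  arbitrary \<open>M\<close> allows averages to be nested.\<close>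

lemma sumset_weighted:
  fixes w :: "'i \<Rightarrow> rat"
  assumes "finite A" "\<And>i. i \<in> A \<Longrightarrow> w i \<ge> 0"
  shows "\<exists>c>0. \<exists>N. \<forall>M v. (\<forall>i\<in>A. v i \<in> sumset X M) \<longrightarrow>
    of_nat c * (\<Sum>i\<in>A. w i * v i) \<in> sumset X (N * M)"
proof -
  obtain c m where c: "c > 0" "\<forall>i\<in>A. of_nat c * w i = of_nat (m i)"
    using common_denominator[of A w] assms by auto
  have "of_nat c * (\<Sum>i\<in>A. w i * v i) \<in> sumset X ((\<Sum>i\<in>A. m i) * M)"
    if "\<forall>i\<in>A. v i \<in> sumset X M" for M v
  proof -
    have "(\<Sum>i\<in>A. of_nat (m i) * v i) \<in> sumset X ((\<Sum>i\<in>A. m i) * M)"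
      using that assms(1) by (intro sumset_sum) auto
    also have "(\<Sum>i\<in>A. of_nat (m i) * v i) = of_nat c * (\<Sum>i\<in>A. w i * v i)"
      unfolding sum_distrib_left
      by (intro sum.cong refl) (use c(2) in \<open>simp add: mult.assoc[symmetric]\<close>)
    finally show ?thesis .
  qed
  then show ?thesis using c(1) by blast
qed

subsection \<open>Sums of four rational squares\<close>

definition sum4sq :: "rat set" where
  "sum4sq = {a^2 + b^2 + c^2 + d^2 | a b c d. True}"

lemma sum4sqI: "x = a^2 + b^2 + c^2 + d^2 \<Longrightarrow> x \<in> sum4sq"
  unfolding sum4sq_def by blast

text \<open>Euler's four-square identity, that is, multiplicativity of the quaternion norm.\<close>

lemma sum4sq_mult:
  assumes "x \<in> sum4sq" "y \<in> sum4sq"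
  shows "x * y \<in> sum4sq"
proof -
  from assms obtain a b c d p q r s where
    x: "x = a^2 + b^2 + c^2 + d^2" and y: "y = p^2 + q^2 + r^2 + s^2"
    unfolding sum4sq_def by blast
  have "x * y = (a*p + b*q + c*r + d*s)^2 + (a*q - b*p + c*s - d*r)^2
      + (a*r - b*s - c*p + d*q)^2 + (a*s + b*r - c*q - d*p)^2"
    unfolding x y by algebra
  then show ?thesis by (rule sum4sqI)
qed

lemma sum4sq_inverse:
  assumes "x \<in> sum4sq"
  shows "inverse x \<in> sum4sq"
proof (cases "x = 0")
  case True
  then show ?thesis using assms by simp
next
  case False
  have "(inverse x)^2 \<in> sum4sq"
    by (rule sum4sqI[of _ "inverse x" 0 0 0]) simp
  then have "x * (inverse x)^2 \<in> sum4sq" using assms sum4sq_mult by blast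
  moreover have "x * (inverse x)^2 = inverse x" using False by (simp add: power2_eq_square)
  ultimately show ?thesis by simp
qed

text \<open>The prime divides (x - y)(x + y), and both factors are smaller than \<open>p\<close> in
  absolute value.\<close>

lemma square_inj_mod_prime:
  fixes p :: nat
  assumes p: "prime p" and x: "x < (p + 1) div 2" and y: "y < (p + 1) div 2"
    and eq: "[x^2 = y^2] (mod p)"
  shows "x = y"
proof -
  have "int p dvd (int x)^2 - (int y)^2"
    using eq by (metis cong_iff_dvd_diff cong_int_iff of_nat_power)
  then have "int p dvd (int x - int y) * (int x + int y)"
    by (simp add: power2_eq_square algebra_simps)
  then have "int p dvd int x - int y \<or> int p dvd int x + int y"
    using p by (simp add: prime_dvd_mult_iff)
  then show ?thesis
  proof
    assume "int p dvd int x - int y"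
    moreover have "\<bar>int x - int y\<bar> < int p" using x y prime_ge_2_nat[OF p] by linarith
    ultimately have "int x - int y = 0" using dvd_imp_le_int[of "int x - int y" "int p"] by linarith
    then show ?thesis by simp
  next
    assume "int p dvd int x + int y"
    then have "p dvd x + y" by (metis of_nat_add of_nat_dvd_iff)
    moreover have "x + y < p" using x y prime_ge_2_nat[OF p] by linarith
    ultimately have "x + y = 0" using dvd_imp_le[of p "x + y"] by linarith
    then show ?thesis by simp
  qed
qed

text \<open>Pigeonhole: for odd \<open>p\<close> the residues of x^2 and of -1 - y^2 form two sets
  of (p + 1)/2 elements each, which must meet.\<close>

lemma prime_dvd_sum_squares_plus_one:
  fixes p :: nat
  assumes p: "prime p"
  obtains x y where "p dvd x^2 + y^2 + 1" "2 * x \<le> p" "2 * y \<le> p"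
proof (cases "p = 2")
  case True
  then show ?thesis using that[of 1 0] by simp
next
  case False
  let ?I = "{..<(p + 1) div 2}"
  define S where "S = (\<lambda>x. x^2 mod p) ` ?I"
  \<comment> \<open>These are the residues of -1 - y^2; the subtraction never truncates because a
    residue is at most \<open>p - 1\<close>.\<close>
  define T where "T = (\<lambda>y. (p - 1) - y^2 mod p) ` ?I"
  have p2: "p \<ge> 2" using p by (rule prime_ge_2_nat)
  have m: "z mod p \<le> p - 1" for z :: nat
    using p2 mod_less_divisor[of p z] by linarith
  have inj: "x = y" if "x^2 mod p = y^2 mod p" "x \<in> ?I" "y \<in> ?I" for x y
    using square_inj_mod_prime[OF p] that by (auto simp: cong_def)
  have "S \<inter> T \<noteq> {}"
  proof
    assume disj: "S \<inter> T = {}"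
    have "inj_on (\<lambda>x. x^2 mod p) ?I"
      using inj by (intro inj_onI) blast
    then have cS: "card S = (p + 1) div 2" unfolding S_def by (simp add: card_image)
    have "inj_on (\<lambda>y. (p - 1) - y^2 mod p) ?I"
    proof (rule inj_onI)
      fix x y assume xy: "x \<in> ?I" "y \<in> ?I" and "(p - 1) - x^2 mod p = (p - 1) - y^2 mod p"
      then have "x^2 mod p = y^2 mod p" using m[of "x^2"] m[of "y^2"] by linarith
      then show "x = y" using inj xy by blast
    qed
    then have cT: "card T = (p + 1) div 2" unfolding T_def by (simp add: card_image)
    have "S \<union> T \<subseteq> {..<p}" unfolding S_def T_def using p2 by auto
    then have "card (S \<union> T) \<le> p" using card_mono[of "{..<p}" "S \<union> T"] by simp
    moreover have "card (S \<union> T) = card S + card T"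
      using disj by (intro card_Un_disjoint) (auto simp: S_def T_def)
    ultimately have "2 * ((p + 1) div 2) \<le> p" using cS cT by simp
    then have "even p" by presburger
    then show False using p False by (metis primes_dvd_imp_eq two_is_prime_nat)
  qed
  then obtain x y where xy: "x < (p + 1) div 2" "y < (p + 1) div 2"
    and "x^2 mod p = (p - 1) - y^2 mod p"
    unfolding S_def T_def by blast
  then have "x^2 mod p + y^2 mod p + 1 = p"
    using m[of "y^2"] p2 by linarith
  then have "(x^2 + y^2 + 1) mod p = 0"
    by (metis mod_add_eq mod_add_left_eq mod_self)
  then show ?thesis using that[of x y] xy by auto
qed

text \<open>Only rational squares are claimed, so inverses are available and replace Lagrange's
  descent: a prime \<open>n\<close> divides x^2 + y^2 + 1 = n m with m < n, and both n m and, by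
  induction, 1/m are sums of four squares.\<close>

lemma of_nat_sum4sq: "of_nat n \<in> sum4sq"
proof (induction n rule: less_induct)
  case (less n)
  consider "n = 0" | "n = 1" | "prime n" | a b where "n = a * b" "a < n" "b < n"
  proof (cases "n \<le> 1 \<or> prime n")
    case False
    then obtain p where p: "prime p" "p dvd n" using prime_factor_nat[of n] by auto
    then obtain k where "n = p * k" by blast
    moreover from this have "k \<noteq> 0" "k \<noteq> 1" using False p by auto
    ultimately show ?thesis
      using that(4)[of p k] prime_gt_1_nat[OF p(1)] by simp
  next
    case True
    then show ?thesis using that(1-3) by linarith
  qed
  then show ?case
  proof cases
    case 1
    then show ?thesis by (intro sum4sqI[of _ 0 0 0 0]) simp
  next
    case 2
    then show ?thesis by (intro sum4sqI[of _ 1 0 0 0]) simp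
  next
    case 4
    then show ?thesis using sum4sq_mult[OF less less] by simp
  next
    case 3
    then obtain x y where xy: "n dvd x^2 + y^2 + 1" "2 * x \<le> n" "2 * y \<le> n"
      using prime_dvd_sum_squares_plus_one by blast
    then obtain m where m: "x^2 + y^2 + 1 = n * m" by blast
    have n2: "n \<ge> 2" using 3 by (rule prime_ge_2_nat)
    \<comment> \<open>The bounds on \<open>x\<close> and \<open>y\<close> give n m \<le> n^2/2 + 1,
      which is below n^2 once n \<ge> 2.\<close>
    have "(2 * x)^2 \<le> n^2" "(2 * y)^2 \<le> n^2" using xy by (simp_all only: power_mono)
    then have "4 * (n * m) \<le> 2 * n^2 + 4" unfolding m[symmetric] by (simp add: power_mult_distrib)
    moreover have "n^2 \<ge> 4" using n2 power_mono[of 2 n 2] by simp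
    ultimately have "n * m < n * n" unfolding power2_eq_square using n2 by linarith
    then have mn: "m < n" by simp
    have m0: "m \<noteq> 0" using m by (metis add_is_0 mult_0_right one_neq_zero)
    have "of_nat (n * m) \<in> sum4sq"
      unfolding m[symmetric] by (intro sum4sqI[of _ "of_nat x" "of_nat y" 1 0]) simp
    then have "of_nat (n * m) * inverse (of_nat m) \<in> sum4sq"
      using less[OF mn] sum4sq_mult sum4sq_inverse by blast
    moreover have "of_nat (n * m) * inverse (of_nat m) = (of_nat n :: rat)" using m0 by simp
    ultimately show ?thesis by metis
  qed
qed

lemma nonneg_sum4sq:
  assumes "(0::rat) \<le> x"
  shows "x \<in> sum4sq"
proof -
  obtain a b where q: "quotient_of x = (a, b)" by (cases "quotient_of x")
  then have b: "b > 0" and x: "x = of_int a / of_int b"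
    by (auto simp: quotient_of_denom_pos quotient_of_div)
  then have "a \<ge> 0" using assms by (simp add: zero_le_divide_iff)
  then have "x = of_nat (nat a) * inverse (of_nat (nat b))"
    using b x by (simp add: field_simps)
  then show ?thesis using of_nat_sum4sq sum4sq_mult sum4sq_inverse by simp
qed

subsection \<open>Heat polynomials and Gaussian moments\<close>

text \<open>The polynomial $e^{a D^2/2} x^n$; for $a = -1$ it is the Hermite polynomial.\<close>

fun heat :: "'a::idom \<Rightarrow> nat \<Rightarrow> 'a poly" where
  "heat a 0 = 1"
| "heat a (Suc n) = [:0, 1:] * heat a n + smult (a * of_nat n) (heat a (n - 1))"

text \<open>The moments of a standard normal variable: zero for odd order, the double factorial (n -
  1)!! for even order \<open>n\<close>. In the recursion the truncated \<open>n - 1\<close> at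
  \<open>n = 0\<close> is harmless because its factor is zero.\<close>

fun gauss_moment :: "nat \<Rightarrow> 'a::idom" where
  "gauss_moment 0 = 1"
| "gauss_moment (Suc n) = of_nat n * gauss_moment (n - 1)"

text \<open>The expectation of p(Z) for standard normal Z, taken as a formal linear functional so
  that it makes sense over the rationals and the reals alike.\<close>

definition gauss_mean :: "'a::idom poly \<Rightarrow> 'a" where
  "gauss_mean p = (\<Sum>k\<le>degree p. coeff p k * gauss_moment k)"

lemma gauss_altdef:
  assumes "degree p \<le> N"
  shows "gauss_mean p = (\<Sum>k\<le>N. coeff p k * gauss_moment k)"
  unfolding gauss_mean_def using assms
  by (intro sum.mono_neutral_left) (auto simp: coeff_eq_0)

lemma gauss_add: "gauss_mean (p + q) = gauss_mean p + gauss_mean q"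
  using gauss_altdef[of p "max (degree p) (degree q)"]
    gauss_altdef[of q "max (degree p) (degree q)"]
    gauss_altdef[of "p + q" "max (degree p) (degree q)"]
  by (simp add: degree_add_le_max sum.distrib algebra_simps)

lemma gauss_smult: "gauss_mean (smult c p) = c * gauss_mean p"
  using gauss_altdef[of "smult c p" "degree p"] gauss_altdef[of p "degree p"]
  by (simp add: sum_distrib_left mult.assoc)

lemma gauss_diff: "gauss_mean (p - q) = gauss_mean p - gauss_mean q"
  using gauss_add[of "p - q" q] by simp

lemma gauss_0: "gauss_mean 0 = 0"
  by (simp add: gauss_mean_def)

lemma gauss_sum: "gauss_mean (\<Sum>i\<in>A. p i) = (\<Sum>i\<in>A. gauss_mean (p i))"
  by (induction A rule: infinite_finite_induct) (simp_all add: gauss_0 gauss_add)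

lemma gauss_const: "gauss_mean [:c:] = c"
  by (simp add: gauss_mean_def)

lemma degree_pderiv_le: "degree (pderiv p) \<le> degree p - 1"
  by (rule degree_le) (auto simp: coeff_pderiv intro!: coeff_eq_0)

text \<open>Stein's identity, Gaussian integration by parts. On monomials it is the recursion of the
  moments.\<close>

lemma gauss_stein: "gauss_mean ([:0, 1:] * p) = gauss_mean (pderiv p)"
proof -
  have "gauss_mean ([:0, 1:] * p) = (\<Sum>k\<le>Suc (degree p). coeff ([:0, 1:] * p) k * gauss_moment k)"
    by (intro gauss_altdef) (simp add: degree_pCons_le)
  also have "\<dots> = (\<Sum>k\<le>degree p. coeff p k * (of_nat k * gauss_moment (k - 1)))"
    by (subst sum.atMost_Suc_shift) simp
  \<comment> \<open>The added top term is zero; with it, the index shift that drops the zero term at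
    \<open>k = 0\<close> ends at \<open>degree p\<close>.\<close>
  also have "\<dots> = (\<Sum>k\<le>Suc (degree p). coeff p k * (of_nat k * gauss_moment (k - 1)))"
    by (simp add: coeff_eq_0)
  also have "\<dots> = (\<Sum>k\<le>degree p. coeff (pderiv p) k * gauss_moment k)"
    by (subst sum.atMost_Suc_shift) (simp add: coeff_pderiv algebra_simps)
  also have "\<dots> = gauss_mean (pderiv p)"
    using degree_pderiv_le[of p] by (intro gauss_altdef[symmetric]) linarith
  finally show ?thesis .
qed

text \<open>The Appell property: e^{a D^2/2} commutes with D. The induction derives it from the
  three-term recurrence.\<close>

lemma pderiv_heat: "pderiv (heat a n) = smult (of_nat n) (heat a (n - 1))"
proof (induction n rule: less_induct)
  case (less n)
  show ?case
  proof (cases n)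
    case (Suc m)
    show ?thesis
    proof (cases m)
      case 0
      then show ?thesis using Suc by (simp add: pderiv_pCons pderiv_mult)
    next
      case (Suc k)
      have "pderiv (heat a n) = heat a m + [:0, 1:] * pderiv (heat a m)
          + smult (a * of_nat m) (pderiv (heat a k))"
        using \<open>n = Suc m\<close> Suc by (simp add: pderiv_mult pderiv_add pderiv_smult pderiv_pCons add.commute)
      also have "\<dots> = heat a m + smult (of_nat m) ([:0, 1:] * heat a k
          + smult (a * of_nat k) (heat a (k - 1)))"
        using less[of m] less[of k] \<open>n = Suc m\<close> Suc
        by (simp add: smult_add_right algebra_simps)
      also have "\<dots> = heat a m + smult (of_nat m) (heat a m)"
        using Suc by simp
      finally show ?thesis using \<open>n = Suc m\<close> by (simp add: smult_add_left)
    qed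
  qed (simp add: pderiv_1)
qed

lemma degree_heat_le: "degree (heat a n) \<le> n"
proof (induction n rule: less_induct)
  case (less n)
  show ?case
  proof (cases n)
    case (Suc m)
    have "degree ([:0, 1:] * heat a m) \<le> Suc m"
      using less[of m] Suc by (simp add: degree_pCons_le order_trans)
    moreover have "degree (smult (a * of_nat m) (heat a (m - 1))) \<le> Suc m"
      using less[of "m - 1"] degree_smult_le[of "a * of_nat m" "heat a (m - 1)"] Suc by linarith
    ultimately show ?thesis using Suc by (simp add: degree_add_le)
  qed simp
qed

lemma coeff_heat_self: "coeff (heat a n) n = 1"
proof (induction n)
  case (Suc n)
  have "coeff (heat a (n - 1)) (Suc n) = 0"
    using degree_heat_le[of a "n - 1"] by (intro coeff_eq_0) linarith
  then show ?case using Suc by simp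
qed simp

lemma degree_heat: "degree (heat a n) = n"
  using degree_heat_le[of a n] le_degree[of "heat a n" n] coeff_heat_self[of a n] by simp

lemma heat_0: "heat 0 n = monom 1 n"
  by (induction n) (simp_all add: monom_Suc monom_0 one_pCons)

lemma poly_heat_Suc:
  "poly (heat a (Suc n)) y = y * poly (heat a n) y + a * of_nat n * poly (heat a (n - 1)) y"
  by simp

lemma pderiv_heat_pcompose:
  "pderiv (heat a n \<circ>\<^sub>p [:y, x:]) = smult (x * of_nat n) (heat a (n - 1) \<circ>\<^sub>p [:y, x:])"
  by (simp add: pderiv_pcompose pderiv_heat pcompose_smult pderiv_pCons mult.commute)

text \<open>The semigroup law of the heat flow: averaging over y + x Z adds x^2 to the variance. In
  the recurrence, Stein's identity replaces the factor x Z by x^2 \<open>m\<close> times the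
  polynomial of index \<open>m - 1\<close>.\<close>

lemma gauss_heat_pcompose:
  "gauss_mean (heat a n \<circ>\<^sub>p [:y, x:]) = poly (heat (a + x^2) n) y"
proof (induction n rule: less_induct)
  case (less n)
  show ?case
  proof (cases n)
    case 0
    then show ?thesis by (simp add: pcompose_1 gauss_const one_pCons)
  next
    case (Suc m)
    let ?H = "\<lambda>k. heat a k \<circ>\<^sub>p [:y, x:]"
    have "?H (Suc m) = smult y (?H m) + smult x ([:0, 1:] * ?H m)
        + smult (a * of_nat m) (?H (m - 1))"
      by (simp add: pcompose_add pcompose_mult pcompose_smult pcompose_pCons)
    then have "gauss_mean (?H (Suc m)) = y * gauss_mean (?H m) + x * gauss_mean (pderiv (?H m))
        + a * of_nat m * gauss_mean (?H (m - 1))"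
      by (simp only: gauss_add gauss_smult gauss_stein)
    then show ?thesis
      unfolding pderiv_heat_pcompose gauss_smult
      using less[of m] less[of "m - 1"] Suc
      by (simp add: power2_eq_square algebra_simps)
  qed
qed

text \<open>Orthogonality of Hermite polynomials. Since H_{n+1} = x H_n - H_n', Stein's identity
  moves one derivative onto \<open>p\<close>; after \<open>n\<close> rounds only the constant n-th
  derivative is left.\<close>

lemma gauss_mult_hermite:
  assumes "degree p \<le> n"
  shows "gauss_mean (heat (-1) n * p) = fact n * coeff p n"
  using assms
proof (induction n arbitrary: p)
  case 0
  then obtain c where "p = [:c:]" by (metis degree_0_id le_zero_eq)
  then show ?case by (simp add: gauss_const)
next
  case (Suc n)
  have "heat (-1) (Suc n) * p = [:0, 1:] * (heat (-1) n * p) - pderiv (heat (-1) n) * p"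
    unfolding pderiv_heat by (simp add: algebra_simps)
  then have "gauss_mean (heat (-1) (Suc n) * p) = gauss_mean (heat (-1) n * pderiv p)"
    by (simp only: gauss_diff gauss_stein) (simp add: pderiv_mult gauss_add mult.commute)
  also have "\<dots> = fact n * coeff (pderiv p) n"
    using Suc.prems degree_pderiv_le[of p] by (intro Suc.IH) linarith
  finally show ?case by (simp add: coeff_pderiv algebra_simps)
qed

subsection \<open>Zeros of Hermite polynomials\<close>

text \<open>Exactly the \<open>n - i\<close> factors with index at least \<open>i\<close> are
  negative.\<close>

lemma prod_diff_sign:
  fixes r :: "nat \<Rightarrow> real"
  assumes "i \<le> n" "\<And>j. j < i \<Longrightarrow> r j < x" "\<And>j. i \<le> j \<Longrightarrow> j < n \<Longrightarrow> x < r j"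
  shows "(-1) ^ (n - i) * (\<Prod>j<n. x - r j) > 0"
  using assms
proof (induction n)
  case (Suc n)
  show ?case
  proof (cases "i = Suc n")
    case True
    then show ?thesis using Suc.prems by (auto intro!: prod_pos simp del: prod.lessThan_Suc)
  next
    case False
    then have "i \<le> n" using Suc.prems by simp
    then have "(-1) ^ (n - i) * (\<Prod>j<n. x - r j) > 0" "x < r n"
      using Suc by auto
    then have "(-1) ^ (n - i) * (\<Prod>j<n. x - r j) * (r n - x) > 0" by simp
    then show ?thesis using \<open>i \<le> n\<close> by (simp add: Suc_diff_le algebra_simps)
  qed
qed simp

lemma strict_interlacing_mono:
  fixes s :: "nat \<Rightarrow> real"
  assumes "strict_mono_on {..<n} s" "i < j" "j < n"
  shows "s i < s j"
  using assms by (auto simp: strict_mono_on_def)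

text \<open>Two monic polynomials of degree \<open>n\<close> differ by a polynomial of degree below
  \<open>n\<close>, which must be zero if it vanishes at \<open>n\<close> points.\<close>

lemma poly_eq_prod_roots:
  fixes p :: "'a::idom poly"
  assumes "degree p = n" "lead_coeff p = 1" "inj_on s {..<n}"
    and "\<And>i. i < n \<Longrightarrow> poly p (s i) = 0"
  shows "p = (\<Prod>j<n. [:- s j, 1:])"
proof -
  let ?q = "\<Prod>j<n. [:- s j, 1:]"
  have dq: "degree ?q = n" by (subst degree_prod_sum_eq) auto
  have lq: "lead_coeff ?q = 1" by (simp add: lead_coeff_prod)
  show ?thesis
  proof (rule ccontr)
    assume "p \<noteq> ?q"
    then have nz: "p - ?q \<noteq> 0" by simp
    have "coeff (p - ?q) n = 0" using assms lq dq by simp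
    moreover have "degree (p - ?q) \<le> n" using assms(1) dq by (simp add: degree_diff_le)
    ultimately have "degree (p - ?q) < n"
      using nz by (metis le_neq_implies_less leading_coeff_0_iff)
    moreover have "poly (p - ?q) x = 0" if "x \<in> s ` {..<n}" for x
      using that assms(4) by (auto simp: poly_prod)
    ultimately have "p - ?q = 0"
      using card_image[OF assms(3)] nz
      by (intro poly_eqI_degree[of "s ` {..<n}"]) auto
    then show False using nz by simp
  qed
qed

lemma exists_sign_change_root:
  fixes p :: "real poly"
  assumes "a < b" "poly p a * poly p b < 0"
  obtains x where "a < x" "x < b" "poly p x = 0"
  using poly_IVT[of a b p] assms by blast

lemma poly_pos_far_right:
  fixes p :: "real poly"
  assumes "lead_coeff p > 0"
  obtains b where "b > c" "poly p b > 0"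
proof -
  obtain n where n: "\<forall>x\<ge>n. poly p x \<ge> lead_coeff p"
    using poly_pinfty_gt_lc[OF assms] by blast
  show ?thesis using that[of "max n c + 1"] n assms
    by (smt (verit))
qed

lemma poly_sign_far_left:
  fixes p :: "real poly"
  assumes "lead_coeff p > 0"
  obtains a where "a < c" "(-1) ^ degree p * poly p a > 0"
proof -
  \<comment> \<open>Reflection reduces the claim to the right end: the sign factor restores the
    leading coefficient of \<open>p\<close>.\<close>
  let ?q = "smult ((-1) ^ degree p) (p \<circ>\<^sub>p [:0, -1:])"
  have "lead_coeff ?q = (-1) ^ degree p * (lead_coeff p * (-1) ^ degree p)"
    by (subst lead_coeff_smult, subst lead_coeff_comp) auto
  also have "\<dots> = lead_coeff p"
    by (metis (no_types, lifting) mult.assoc mult.commute mult.right_neutral power_mult_distrib mult_minus1_right minus_minus power_one)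
  finally have "lead_coeff ?q > 0" using assms by simp
  then obtain b where b: "b > - c" "poly ?q b > 0" by (rule poly_pos_far_right)
  show ?thesis using that[of "- b"] b by (simp add: poly_pcompose)
qed

declare heat.simps(2) [simp del]

text \<open>Consecutive Hermite polynomials interlace: the last conjunct is what carries the induction.\<close>

lemma hermite_roots:
  "\<exists>r :: nat \<Rightarrow> real. strict_mono_on {..<Suc n} r \<and>
     heat (-1) (Suc n) = (\<Prod>j<Suc n. [:- r j, 1:]) \<and>
     (\<forall>i<Suc n. (-1) ^ (n - i) * poly (heat (-1) n) (r i) > 0)"
proof (induction n)
  case 0
  show ?case by (intro exI[of _ "\<lambda>_. 0"]) (auto simp: strict_mono_on_def heat.simps(2))
next
  case (Suc n)
  then obtain r :: "nat \<Rightarrow> real" where mono: "strict_mono_on {..<Suc n} r"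
    and fac: "heat (-1) (Suc n) = (\<Prod>j<Suc n. [:- r j, 1:])"
    and sgn: "\<And>i. i < Suc n \<Longrightarrow> (-1) ^ (n - i) * poly (heat (-1) n) (r i) > 0"
    by blast
  let ?p = "heat (-1) (Suc (Suc n)) :: real poly"
  have lc: "lead_coeff ?p = 1" by (simp only: degree_heat coeff_heat_self)
  have root: "poly (heat (-1) (Suc n)) (r i) = 0" if "i < Suc n" for i
    unfolding fac poly_prod using that by (intro prod_zero) auto
  \<comment> \<open>At a zero of H_{n+1} the recurrence leaves H_{n+2} = -(n + 1) H_n, so H_{n+2}
    inherits alternating signs there.\<close>
  have sp: "(-1) ^ (Suc n - i) * poly ?p (r i) > 0" if "i < Suc n" for i
  proof -
    have "poly ?p (r i) = - (of_nat (Suc n) * poly (heat (-1) n) (r i))"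
      using root[OF that] by (subst poly_heat_Suc) (simp add: algebra_simps)
    then have "(-1) ^ (Suc n - i) * poly ?p (r i)
        = of_nat (Suc n) * ((-1) ^ (n - i) * poly (heat (-1) n) (r i))"
      using that by (simp add: Suc_diff_le)
    also have "\<dots> > 0" by (rule mult_pos_pos[OF _ sgn[OF that]]) simp
    finally show ?thesis .
  qed
  obtain b where b: "b > r n" "poly ?p b > 0"
    using lc by (metis poly_pos_far_right zero_less_one)
  obtain a where a: "a < r 0" "(-1) ^ Suc (Suc n) * poly ?p a > 0"
    using lc degree_heat[of "-1::real" "Suc (Suc n)"] by (metis poly_sign_far_left zero_less_one)
  \<comment> \<open>The \<open>n + 1\<close> zeros of H_{n+1}, flanked by the far points
    \<open>a\<close> and \<open>b\<close>. The sign of H_{n+2} alternates along all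
    \<open>n + 3\<close> points, so each of the \<open>n + 2\<close> gaps contains a zero, which
    accounts for the whole degree.\<close>
  define e where "e i = (if i = 0 then a else if i = Suc (Suc n) then b else r (i - 1))" for i
  have e_sgn: "(-1) ^ (Suc (Suc n) - i) * poly ?p (e i) > 0" if i: "i \<le> Suc (Suc n)" for i
  proof -
    consider "i = 0" | "i = Suc (Suc n)" | "0 < i" "i < Suc (Suc n)"
      using i by linarith
    then show ?thesis
    proof cases
      case 1
      then show ?thesis using a by (simp add: e_def)
    next
      case 2
      then show ?thesis using b by (simp add: e_def)
    next
      case 3
      then have "Suc n - (i - 1) = Suc (Suc n) - i" "i - 1 < Suc n" by linarith+
      then show ?thesis using 3 sp[of "i - 1"] by (simp add: e_def)
    qed
  qed
  have e_mono: "e i < e (Suc i)" if "i < Suc (Suc n)" for i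
    using that a(1) b(1) strict_interlacing_mono[OF mono, of "i - 1" i]
    by (auto simp: e_def)
  have "\<exists>x. e i < x \<and> x < e (Suc i) \<and> poly ?p x = 0" if "i < Suc (Suc n)" for i
  proof -
    have "0 < ((-1) ^ (Suc (Suc n) - i) * poly ?p (e i))
        * ((-1) ^ (Suc (Suc n) - Suc i) * poly ?p (e (Suc i)))"
      by (rule mult_pos_pos) (use e_sgn[of i] e_sgn[of "Suc i"] that in simp_all)
    also have "\<dots> = (-1) ^ Suc (2 * (Suc n - i)) * (poly ?p (e i) * poly ?p (e (Suc i)))"
      using that by (simp add: Suc_diff_le power_add mult_2)
    finally have "poly ?p (e i) * poly ?p (e (Suc i)) < 0"
      by simp
    then show ?thesis using exists_sign_change_root e_mono[OF that] by metis
  qed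
  then obtain s where s: "\<And>i. i < Suc (Suc n) \<Longrightarrow> e i < s i \<and> s i < e (Suc i) \<and> poly ?p (s i) = 0"
    by metis
  have e_le: "e i \<le> e j" if "i \<le> j" "j \<le> Suc (Suc n)" for i j
    using that
  proof (induction j rule: dec_induct)
    case (step k)
    then show ?case using e_mono[of k] by simp
  qed simp
  have smono: "strict_mono_on {..<Suc (Suc n)} s"
  proof (rule strict_mono_onI)
    fix i j assume "i \<in> {..<Suc (Suc n)}" "j \<in> {..<Suc (Suc n)}" "i < j"
    then show "s i < s j" using s[of i] s[of j] e_le[of "Suc i" j] by fastforce
  qed
  have sfac: "?p = (\<Prod>j<Suc (Suc n). [:- s j, 1:])"
    using smono s degree_heat[of "-1::real" "Suc (Suc n)"] lc
    by (intro poly_eq_prod_roots) (auto intro: strict_mono_on_imp_inj_on)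
  \<comment> \<open>The new zero \<open>s i\<close> lies right of all \<open>r j\<close> with
    \<open>j < i\<close> and left of the others, so the factorization of H_{n+1} gives its sign
    there and restores the induction invariant.\<close>
  have "(-1) ^ (Suc n - i) * poly (heat (-1) (Suc n)) (s i) > 0" if i: "i < Suc (Suc n)" for i
  proof -
    have "r j < s i" if "j < i" for j
    proof -
      have "e (Suc j) \<le> e i" using that i by (intro e_le) auto
      then show ?thesis using that i s[of i] by (auto simp: e_def)
    qed
    moreover have "s i < r j" if "i \<le> j" "j < Suc n" for j
    proof -
      have "e (Suc i) \<le> e (Suc j)" using that i by (intro e_le) auto
      then show ?thesis using that i s[of i] by (auto simp: e_def)
    qed
    ultimately have "(-1) ^ (Suc n - i) * (\<Prod>j<Suc n. s i - r j) > 0"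
      using i by (intro prod_diff_sign) auto
    moreover have "poly (heat (-1) (Suc n)) (s i) = (\<Prod>j<Suc n. s i - r j)"
      unfolding fac poly_prod by simp
    ultimately show ?thesis by simp
  qed
  then show ?case using smono sfac by blast
qed

subsection \<open>Rational quadrature\<close>

definition node_poly :: "(nat \<Rightarrow> 'a::idom) \<Rightarrow> nat set \<Rightarrow> 'a poly" where
  "node_poly b A = (\<Prod>j\<in>A. [:- b j, 1:])"

lemma degree_node_poly: "finite A \<Longrightarrow> degree (node_poly b A) = card A"
  unfolding node_poly_def by (subst degree_prod_sum_eq) auto

lemma coeff_node_poly_card: "finite A \<Longrightarrow> coeff (node_poly b A) (card A) = 1"
  using lead_coeff_prod[of "\<lambda>j. [:- b j, 1:]" A] degree_node_poly[of A b]
  by (simp add: node_poly_def)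

lemma poly_node_poly: "poly (node_poly b A) x = (\<Prod>j\<in>A. x - b j)"
  by (simp add: node_poly_def poly_prod)

lemma node_poly_insert:
  "finite A \<Longrightarrow> i \<notin> A \<Longrightarrow> node_poly b (insert i A) = [:- b i, 1:] * node_poly b A"
  by (simp add: node_poly_def)

lemma gauss_node_poly:
  "finite A \<Longrightarrow> gauss_mean (node_poly b A) = (\<Sum>k\<le>card A. coeff (node_poly b A) k * gauss_moment k)"
  by (intro gauss_altdef) (simp add: degree_node_poly)

text \<open>The Gaussian mean of the Lagrange basis polynomial of node \<open>i\<close>, hence a
  rational function of the nodes with rational coefficients.\<close>

definition weight :: "(nat \<Rightarrow> 'a::field) \<Rightarrow> nat \<Rightarrow> nat \<Rightarrow> 'a" where
  "weight b n i = gauss_mean (node_poly b ({..<n} - {i})) / poly (node_poly b ({..<n} - {i})) (b i)"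

text \<open>A polynomial of degree below \<open>n\<close> equals its Lagrange interpolant; apply the
  linear functional \<open>gauss_mean\<close> to both.\<close>

lemma interpolatory_quadrature:
  fixes b :: "nat \<Rightarrow> 'a::field"
  assumes inj: "inj_on b {..<n}" and deg: "degree p < n"
  shows "(\<Sum>i<n. weight b n i * poly p (b i)) = gauss_mean p"
proof -
  let ?q = "\<lambda>i. node_poly b ({..<n} - {i})"
  let ?s = "\<Sum>i<n. smult (poly p (b i) / poly (?q i) (b i)) (?q i)"
  have q0: "poly (?q i) (b j) = 0" if "i \<noteq> j" "j < n" for i j
    unfolding poly_node_poly using that by (intro prod_zero) auto
  have q1: "poly (?q i) (b i) \<noteq> 0" if "i < n" for i
    unfolding poly_node_poly using that inj by (auto simp: inj_on_def)
  have "degree ?s \<le> n - 1"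
    by (intro degree_sum_le) (auto intro!: order.trans[OF degree_smult_le] simp: degree_node_poly)
  moreover have "poly ?s x = poly p x" if x: "x \<in> b ` {..<n}" for x
  proof -
    obtain j where j: "j < n" "x = b j" using x by blast
    have "poly ?s x = (\<Sum>i<n. if i = j then poly p (b j) else 0)"
      unfolding poly_sum
    proof (intro sum.cong refl)
      fix i assume "i \<in> {..<n}"
      then show "poly (smult (poly p (b i) / poly (?q i) (b i)) (?q i)) x
          = (if i = j then poly p (b j) else 0)"
        using j q0[of i j] q1[of i] by (cases "i = j") simp_all
    qed
    then show ?thesis using j by simp
  qed
  ultimately have "?s = p"
    using deg card_image[OF inj] by (intro poly_eqI_degree[of "b ` {..<n}"]) auto
  then have "gauss_mean p = gauss_mean ?s" by simp
  also have "\<dots> = (\<Sum>i<n. weight b n i * poly p (b i))"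
    by (simp add: gauss_sum gauss_smult weight_def mult.commute)
  finally show ?thesis by simp
qed

text \<open>The weight at the root $r_i$ of $H_{n+1}$ is $n! / ((n + 1) H_n(r_i)^2)$. As positivity is an open
  condition, it survives moving the nodes to nearby rational points.\<close>

lemma weight_hermite_pos:
  fixes r :: "nat \<Rightarrow> real"
  assumes fac: "heat (-1) (Suc n) = (\<Prod>j<Suc n. [:- r j, 1:])"
    and nz: "poly (heat (-1) n) (r i) \<noteq> 0" and i: "i < Suc n"
  shows "weight r (Suc n) i > 0"
proof -
  let ?A = "{..<Suc n} - {i}"
  let ?q = "node_poly r ?A" and ?h = "poly (heat (-1) n) (r i)"
  let ?s = "synthetic_div (heat (-1) n) (r i)"
  have cA: "card ?A = n" using i by simp
  have H: "heat (-1) (Suc n) = [:- r i, 1:] * ?q"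
    using node_poly_insert[of ?A i r] i unfolding fac node_poly_def[symmetric]
    by (simp add: insert_absorb)
  \<comment> \<open>Computing H_{n+1}'(r_i) from the factorization and from the Appell property
    gives the denominator of the weight.\<close>
  have "poly (pderiv (heat (-1) (Suc n))) (r i) = poly ?q (r i)"
    unfolding H pderiv_mult by (simp add: pderiv_pCons)
  then have q: "poly ?q (r i) = of_nat (Suc n) * ?h"
    unfolding pderiv_heat by simp
  \<comment> \<open>Dividing H_n by x - r_i yields H_n q = H_{n+1} s + H_n(r_i) q. Orthogonality
    kills the mean of H_{n+1} s, and H_n q has mean n! because q is monic of degree
    \<open>n\<close>.\<close>
  have "heat (-1) n * ?q = ([:- r i, 1:] * ?s + [:?h:]) * ?q"
    by (simp only: synthetic_div_correct')
  also have "\<dots> = heat (-1) (Suc n) * ?s + smult ?h ?q"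
    unfolding H by (simp add: algebra_simps)
  finally have "gauss_mean (heat (-1) n * ?q) = gauss_mean (heat (-1) (Suc n) * ?s) + ?h * gauss_mean ?q"
    by (simp only: gauss_add gauss_smult)
  moreover have "gauss_mean (heat (-1) n * ?q) = fact n"
    using cA degree_node_poly[of ?A r] coeff_node_poly_card[of ?A r]
    by (subst gauss_mult_hermite) auto
  moreover have "gauss_mean (heat (-1) (Suc n) * ?s) = 0"
    by (subst gauss_mult_hermite) (auto simp: degree_synthetic_div degree_heat coeff_eq_0)
  ultimately have "?h * gauss_mean ?q = fact n" by simp
  then have "weight r (Suc n) i = fact n / (of_nat (Suc n) * ?h^2)"
    using nz q unfolding weight_def by (simp add: field_simps power2_eq_square del: of_nat_Suc)
  also have "\<dots> > 0" using nz by simp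
  finally show ?thesis .
qed

section \<open>Continuity of the weights in the nodes and passage to rational nodes\<close>

lemma tendsto_coeff_node_poly:
  fixes r :: "nat \<Rightarrow> real"
  assumes "finite A" "\<And>j. j \<in> A \<Longrightarrow> (\<lambda>k. b k j) \<longlonglongrightarrow> r j"
  shows "(\<lambda>k. coeff (node_poly (b k) A) m) \<longlonglongrightarrow> coeff (node_poly r A) m"
  using assms
proof (induction A arbitrary: m rule: finite_induct)
  case (insert i A)
  have "coeff (node_poly b (insert i A)) m
      = - b i * coeff (node_poly b A) m + (if m = 0 then 0 else coeff (node_poly b A) (m - 1))"
    for b :: "nat \<Rightarrow> real"
    using insert.hyps by (cases m) (simp_all add: node_poly_insert)
  then show ?case using insert by (auto intro!: tendsto_intros)
qed (simp add: node_poly_def)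

lemma tendsto_weight:
  fixes r :: "nat \<Rightarrow> real"
  assumes "inj_on r {..<n}" "i < n" "\<And>j. j < n \<Longrightarrow> (\<lambda>k. b k j) \<longlonglongrightarrow> r j"
  shows "(\<lambda>k. weight (b k) n i) \<longlonglongrightarrow> weight r n i"
proof -
  have "(\<Prod>j\<in>{..<n} - {i}. r i - r j) \<noteq> 0"
    using assms by (auto simp: inj_on_def)
  then show ?thesis
    unfolding weight_def poly_node_poly using assms
    by (intro tendsto_divide) (auto simp: gauss_node_poly intro!: tendsto_intros tendsto_coeff_node_poly)
qed

lemma of_rat_gauss_moment: "of_rat (gauss_moment k) = (gauss_moment k :: real)"
proof (induction k rule: less_induct)
  case (less k)
  show ?case
  proof (cases k)
    case (Suc m)
    then show ?thesis using less[of "m - 1"] by (simp add: of_rat_mult)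
  qed simp
qed

lemma of_rat_coeff_node_poly:
  assumes "finite A"
  shows "of_rat (coeff (node_poly b A) m) = coeff (node_poly (\<lambda>j. of_rat (b j) :: real) A) m"
  using assms
proof (induction A arbitrary: m rule: finite_induct)
  case (insert i A)
  then show ?case
    by (cases m) (simp_all add: node_poly_insert of_rat_add of_rat_mult of_rat_minus of_rat_diff)
qed (simp add: node_poly_def)

lemma of_rat_weight:
  "of_rat (weight b n i) = weight (\<lambda>j. of_rat (b j) :: real) n i"
  unfolding weight_def poly_node_poly
  by (simp add: of_rat_divide gauss_node_poly of_rat_sum of_rat_mult of_rat_prod of_rat_diff
      of_rat_gauss_moment of_rat_coeff_node_poly)

lemma rat_sequence_tendsto:
  "\<exists>b :: nat \<Rightarrow> rat. (\<lambda>k. of_rat (b k)) \<longlonglongrightarrow> (r :: real)"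
proof -
  have "\<exists>q. r < of_rat q \<and> of_rat q < r + inverse (real (Suc k))" for k
    by (rule of_rat_dense) simp
  then obtain b where b: "\<And>k. r < of_rat (b k) \<and> of_rat (b k) < r + inverse (real (Suc k))"
    by metis
  have "(\<lambda>k. r + inverse (real (Suc k))) \<longlonglongrightarrow> r + 0"
    by (intro tendsto_intros LIMSEQ_inverse_real_of_nat)
  then have lim: "(\<lambda>k. r + inverse (real (Suc k))) \<longlonglongrightarrow> r" by simp
  have "(\<lambda>k. of_rat (b k)) \<longlonglongrightarrow> r"
  proof (rule tendsto_sandwich[OF _ _ tendsto_const lim])
    show "\<forall>\<^sub>F k in sequentially. r \<le> of_rat (b k)"
      "\<forall>\<^sub>F k in sequentially. of_rat (b k) \<le> r + inverse (real (Suc k))"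
      using b by (simp_all add: less_imp_le)
  qed
  then show ?thesis by blast
qed

text \<open>Any \<open>n + 1\<close> distinct nodes give exactness up to degree \<open>n\<close>;
  closeness to the Hermite zeros makes the weights positive.\<close>

lemma rational_gauss_quadrature:
  "\<exists>b w :: nat \<Rightarrow> rat. (\<forall>i\<le>n. w i > 0) \<and>
    (\<forall>p. degree p \<le> n \<longrightarrow> (\<Sum>i\<le>n. w i * poly p (b i)) = gauss_mean p)"
proof -
  obtain r :: "nat \<Rightarrow> real" where r: "strict_mono_on {..<Suc n} r"
      "heat (-1) (Suc n) = (\<Prod>j<Suc n. [:- r j, 1:])"
      "\<And>i. i < Suc n \<Longrightarrow> (-1) ^ (n - i) * poly (heat (-1) n) (r i) > 0"
    using hermite_roots by blast
  have inj: "inj_on r {..<Suc n}" using r(1) by (rule strict_mono_on_imp_inj_on)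
  obtain b :: "nat \<Rightarrow> nat \<Rightarrow> rat" where b: "\<And>j. (\<lambda>k. of_rat (b j k)) \<longlonglongrightarrow> r j"
    using choice[of "\<lambda>j b. (\<lambda>k. of_rat (b k)) \<longlonglongrightarrow> r j"] rat_sequence_tendsto by blast
  have "\<forall>\<^sub>F k in sequentially. weight (\<lambda>j. of_rat (b j k) :: real) (Suc n) i > 0"
    if i: "i < Suc n" for i
  proof (rule order_tendstoD)
    show "(\<lambda>k. weight (\<lambda>j. of_rat (b j k)) (Suc n) i) \<longlonglongrightarrow> weight r (Suc n) i"
      using inj i b by (intro tendsto_weight) auto
    show "weight r (Suc n) i > 0"
      using weight_hermite_pos[OF r(2) _ i] r(3)[OF i] by fastforce
  qed
  then have "\<forall>\<^sub>F k in sequentially. \<forall>i\<in>{..<Suc n}. weight (\<lambda>j. of_rat (b j k) :: real) (Suc n) i > 0"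
    by (intro eventually_ball_finite) auto
  then obtain k where k: "\<And>i. i < Suc n \<Longrightarrow> weight (\<lambda>j. of_rat (b j k) :: real) (Suc n) i > 0"
    by (auto simp: eventually_sequentially)
  define c where "c j = b j k" for j
  have pos: "weight c (Suc n) i > 0" if "i < Suc n" for i
    using k[OF that] of_rat_weight[of c "Suc n" i] unfolding c_def by (metis zero_less_of_rat_iff)
  \<comment> \<open>Distinctness follows from positivity: if two nodes coincided, the denominator of
    a weight would vanish, and division by zero makes that weight 0.\<close>
  have "inj_on c {..<Suc n}"
  proof (rule inj_onI)
    fix i j assume ij: "i \<in> {..<Suc n}" "j \<in> {..<Suc n}" "c i = c j"
    show "i = j"
    proof (rule ccontr)
      assume "i \<noteq> j"
      then have "(\<Prod>l\<in>{..<Suc n} - {i}. c i - c l) = 0"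
        using ij by (intro prod_zero) auto
      then have "weight c (Suc n) i = 0"
        by (simp only: weight_def poly_node_poly div_by_0)
      then show False using pos[of i] ij by simp
    qed
  qed
  then have "(\<Sum>i\<le>n. weight c (Suc n) i * poly p (c i)) = gauss_mean p" if "degree p \<le> n" for p
    using interpolatory_quadrature[of c "Suc n" p] that
    by (simp add: lessThan_Suc_atMost less_Suc_eq_le)
  then show ?thesis using pos by (intro exI[of _ c] exI[of _ "weight c (Suc n)"]) auto
qed

subsection \<open>Representing an interval\<close>

definition heat_flow :: "rat poly \<Rightarrow> rat \<Rightarrow> rat poly" where
  "heat_flow f a = (\<Sum>m\<le>degree f. smult (coeff f m) (heat a m))"

text \<open>This is the derivative of the heat flow of $f$.\<close>

definition heat_flow_deriv :: "rat poly \<Rightarrow> rat \<Rightarrow> rat poly" where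
  "heat_flow_deriv f a = (\<Sum>m\<le>degree f. smult (coeff f m * of_nat m) (heat a (m - 1)))"

lemma heat_flow_0: "heat_flow f 0 = f"
  unfolding heat_flow_def heat_0 by (simp add: smult_monom poly_as_sum_of_monoms)

text \<open>Only the summand of index \<open>degree f\<close> contributes in degree
  \<open>degree f - 1\<close>, and its contribution is the leading coefficient times the
  degree.\<close>

lemma heat_flow_deriv_nonzero:
  assumes "degree f \<ge> 1"
  shows "heat_flow_deriv f a \<noteq> 0"
proof -
  let ?d = "degree f"
  have "coeff (heat_flow_deriv f a) (?d - 1)
      = (\<Sum>m\<le>?d. if m = ?d then coeff f ?d * of_nat ?d else 0)"
    unfolding heat_flow_deriv_def coeff_sum
  proof (intro sum.cong refl)
    fix m assume m: "m \<in> {..?d}"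
    show "coeff (smult (coeff f m * of_nat m) (heat a (m - 1))) (?d - 1)
        = (if m = ?d then coeff f ?d * of_nat ?d else 0)"
    \<comment> \<open>For \<open>m = 0\<close> the index \<open>m - 1\<close> truncates to 0, which
      equals \<open>?d - 1\<close> when \<open>f\<close> is linear; there the factor
      \<open>of_nat m\<close> gives zero.\<close>
    proof (cases "m = ?d \<or> m = 0")
      case True
      then show ?thesis using assms coeff_heat_self[of a "?d - 1"] by auto
    next
      case False
      then have "coeff (heat a (m - 1)) (?d - 1) = 0"
        using m degree_heat_le[of a "m - 1"] by (intro coeff_eq_0) auto
      then show ?thesis using False by simp
    qed
  qed
  also have "\<dots> \<noteq> 0" using assms by auto
  finally show ?thesis by auto
qed

text \<open>The rule is exact one degree beyond \<open>f\<close> because the tilt by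
  \<open>b i\<close> raises the degree by one.\<close>

locale quadrature =
  fixes b w :: "nat \<Rightarrow> rat" and n :: nat and f :: "rat poly"
  assumes exact: "degree p \<le> n \<Longrightarrow> (\<Sum>i\<le>n. w i * poly p (b i)) = gauss_mean p"
    and degree_less: "degree f < n"
begin

lemma average_heat:
  assumes "m \<le> n"
  shows "(\<Sum>i\<le>n. w i * poly (heat a m) (y + x * b i)) = poly (heat (a + x^2) m) y"
proof -
  have "degree (heat a m \<circ>\<^sub>p [:y, x:]) \<le> n"
    using assms by (simp add: degree_pcompose degree_heat)
  from exact[OF this] show ?thesis
    by (simp add: gauss_heat_pcompose poly_pcompose mult.commute)
qed

lemma average_tilted_heat:
  assumes "m < n"
  shows "(\<Sum>i\<le>n. w i * (b i * poly (heat a m) (y + x * b i)))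
    = x * (of_nat m * poly (heat (a + x^2) (m - 1)) y)"
proof -
  let ?H = "heat a m \<circ>\<^sub>p [:y, x:]"
  have "degree ([:0, 1:] * ?H) \<le> 1 + degree ?H"
    using degree_mult_le[of "[:0, 1:]" ?H] by simp
  also have "degree ?H \<le> m" by (simp add: degree_pcompose degree_heat)
  finally have "degree ([:0, 1:] * ?H) \<le> n" using assms by simp
  from exact[OF this] have "(\<Sum>i\<le>n. w i * poly ([:0, 1:] * ?H) (b i)) = gauss_mean (pderiv ?H)"
    by (simp only: gauss_stein)
  also have "\<dots> = x * (of_nat m * poly (heat (a + x^2) (m - 1)) y)"
    by (simp add: pderiv_heat_pcompose gauss_smult gauss_heat_pcompose)
  finally show ?thesis by (simp add: poly_pcompose mult.commute)
qed

lemma average_heat_flow: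
  "(\<Sum>i\<le>n. w i * poly (heat_flow f a) (y + x * b i)) = poly (heat_flow f (a + x^2)) y"
proof -
  have "(\<Sum>i\<le>n. w i * poly (heat_flow f a) (y + x * b i))
      = (\<Sum>m\<le>degree f. \<Sum>i\<le>n. coeff f m * (w i * poly (heat a m) (y + x * b i)))"
    unfolding heat_flow_def poly_sum sum_distrib_left
    by (subst sum.swap) (simp add: mult.left_commute)
  also have "\<dots> = (\<Sum>m\<le>degree f. coeff f m * poly (heat (a + x^2) m) y)"
    unfolding sum_distrib_left[symmetric]
    using degree_less by (intro sum.cong refl) (simp add: average_heat)
  finally show ?thesis by (simp add: heat_flow_def poly_sum)
qed

text \<open>The plain average depends on \<open>x\<close> only through x^2; the tilt adds, by
  Stein's identity, a term that is linear in \<open>x\<close> once a + x^2 is held fixed.\<close>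

lemma average_tilted_heat_flow:
  "(\<Sum>i\<le>n. w i * (1 + e * b i) * poly (heat_flow f a) (y + x * b i))
    = poly (heat_flow f (a + x^2)) y + e * x * poly (heat_flow_deriv f (a + x^2)) y"
proof -
  have "(\<Sum>i\<le>n. w i * (b i * poly (heat_flow f a) (y + x * b i)))
      = (\<Sum>m\<le>degree f. \<Sum>i\<le>n. coeff f m * (w i * (b i * poly (heat a m) (y + x * b i))))"
    unfolding heat_flow_def poly_sum sum_distrib_left
    by (subst sum.swap) (simp add: mult.left_commute)
  also have "\<dots> = (\<Sum>m\<le>degree f. coeff f m * (x * (of_nat m * poly (heat (a + x^2) (m - 1)) y)))"
    unfolding sum_distrib_left[symmetric]
    using degree_less by (intro sum.cong refl) (simp add: average_tilted_heat)
  also have "\<dots> = x * poly (heat_flow_deriv f (a + x^2)) y"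
    by (simp add: heat_flow_deriv_def poly_sum sum_distrib_left algebra_simps)
  finally have tilt: "(\<Sum>i\<le>n. w i * (b i * poly (heat_flow f a) (y + x * b i)))
      = x * poly (heat_flow_deriv f (a + x^2)) y" .
  have "(\<Sum>i\<le>n. w i * (1 + e * b i) * poly (heat_flow f a) (y + x * b i))
      = (\<Sum>i\<le>n. w i * poly (heat_flow f a) (y + x * b i))
        + e * (\<Sum>i\<le>n. w i * (b i * poly (heat_flow f a) (y + x * b i)))"
    unfolding sum_distrib_left sum.distrib[symmetric]
    by (intro sum.cong refl) (simp add: algebra_simps)
  then show ?thesis by (simp add: average_heat_flow tilt)
qed

end

lemma sumset_contains_interval:
  fixes f :: "rat poly"
  assumes "degree f \<ge> 1"
  obtains M \<alpha> \<beta> where "\<alpha> < \<beta>" "{\<alpha><..<\<beta>} \<subseteq> sumset (range (poly f)) M"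
proof -
  let ?X = "range (poly f)"
  define n where "n = Suc (degree f)"
  obtain b w :: "nat \<Rightarrow> rat" where w: "\<And>i. i \<le> n \<Longrightarrow> w i > 0"
    and exact: "\<And>p. degree p \<le> n \<Longrightarrow> (\<Sum>i\<le>n. w i * poly p (b i)) = gauss_mean p"
    using rational_gauss_quadrature[of n] by auto
  interpret quadrature b w n f
    using exact by unfold_locales (auto simp: n_def)
  \<comment> \<open>Small enough that every tilted weight stays nonnegative, yet positive, so that
    the linear term survives.\<close>
  define e where "e = 1 / (1 + (\<Sum>i\<le>n. \<bar>b i\<bar>))"
  have e_denom: "1 + (\<Sum>i\<le>n. \<bar>b i\<bar>) > 0" by (simp add: add_pos_nonneg sum_nonneg)
  then have e: "e > 0" by (simp add: e_def)
  have u: "w i * (1 + e * b i) \<ge> 0" if "i \<le> n" for i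
  proof -
    have "\<bar>b i\<bar> \<le> (\<Sum>i\<le>n. \<bar>b i\<bar>)" using that by (intro member_le_sum) auto
    then have "\<bar>e * b i\<bar> \<le> 1" using e_denom by (simp add: e_def abs_mult field_simps)
    then show ?thesis using w[OF that] by (intro mult_nonneg_nonneg) auto
  qed
  obtain c N where c: "c > 0" and cN: "\<And>M v. \<forall>i\<in>{..n}. v i \<in> sumset ?X M \<Longrightarrow>
      of_nat c * (\<Sum>i\<le>n. w i * v i) \<in> sumset ?X (N * M)"
    using sumset_weighted[of "{..n}" w ?X] w by (auto simp: less_imp_le)
  obtain c' N' where c': "c' > 0" and cN': "\<And>M v. \<forall>i\<in>{..n}. v i \<in> sumset ?X M \<Longrightarrow>
      of_nat c' * (\<Sum>i\<le>n. w i * (1 + e * b i) * v i) \<in> sumset ?X (N' * M)"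
    using sumset_weighted[of "{..n}" "\<lambda>i. w i * (1 + e * b i)" ?X] u by auto
  \<comment> \<open>One plain average adds a rational square to the variance, at the cost of a
    factor \<open>c\<close> in the value and \<open>N\<close> in the number of summands.\<close>
  have step: "of_nat c * C * poly (heat_flow f (a + x^2)) y \<in> sumset ?X (N * M)"
    if "\<And>y. C * poly (heat_flow f a) y \<in> sumset ?X M" for C a M x y
  proof -
    have "of_nat c * (\<Sum>i\<le>n. w i * (C * poly (heat_flow f a) (y + x * b i))) \<in> sumset ?X (N * M)"
      using that by (intro cN) blast
    also have "(\<Sum>i\<le>n. w i * (C * poly (heat_flow f a) (y + x * b i)))
        = C * poly (heat_flow f (a + x^2)) y"
      unfolding average_heat_flow[symmetric] sum_distrib_left by (simp add: mult.left_commute)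
    finally show ?thesis by (simp add: mult.assoc)
  qed
  \<comment> \<open>Four rounds of \<open>step\<close> starting from single values of
    \<open>f\<close>, hence the innermost 1. Since four squares always suffice, \<open>C\<close> and
    \<open>M\<close> do not depend on the variance reached.\<close>
  define C :: rat where "C = of_nat c * (of_nat c * (of_nat c * (of_nat c * 1)))"
  define M where "M = N * (N * (N * (N * 1)))"
  have four: "C * poly (heat_flow f a) y \<in> sumset ?X M" if a: "a \<ge> 0" for a y
  proof -
    obtain p q r s where a: "a = 0 + p^2 + q^2 + r^2 + s^2"
      using nonneg_sum4sq[OF a] unfolding sum4sq_def by auto
    show ?thesis unfolding C_def M_def a
      by (intro step) (simp only: heat_flow_0 sumset_1 mult_1 rangeI)
  qed
  obtain y where y: "poly (heat_flow_deriv f 1) y \<noteq> 0"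
    using heat_flow_deriv_nonzero[OF assms] poly_all_0_iff_0 by blast
  define A where "A = of_nat c' * (C * poly (heat_flow f 1) y)"
  define B where "B = of_nat c' * (C * (e * poly (heat_flow_deriv f 1) y))"
  have B: "B \<noteq> 0" using c c' e y by (simp add: B_def C_def)
  \<comment> \<open>Start at variance 1 - t^2 and take a tilted average of step \<open>t\<close>:
    the variance becomes 1 for every \<open>t\<close>, so the value is affine in
    \<open>t\<close>.\<close>
  have tilted: "A + B * t \<in> sumset ?X (N' * M)" if t: "\<bar>t\<bar> \<le> 1" for t
  proof -
    have "1 - t^2 \<ge> 0" using t by (simp add: abs_square_le_1)
    then have "of_nat c' * (\<Sum>i\<le>n. w i * (1 + e * b i)
        * (C * poly (heat_flow f (1 - t^2)) (y + t * b i))) \<in> sumset ?X (N' * M)"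
      using four by (intro cN') blast
    also have "(\<Sum>i\<le>n. w i * (1 + e * b i) * (C * poly (heat_flow f (1 - t^2)) (y + t * b i)))
        = C * (\<Sum>i\<le>n. w i * (1 + e * b i) * poly (heat_flow f (1 - t^2)) (y + t * b i))"
      unfolding sum_distrib_left by (simp add: mult.left_commute)
    also have "\<dots> = C * (poly (heat_flow f 1) y + e * t * poly (heat_flow_deriv f 1) y)"
      unfolding average_tilted_heat_flow by simp
    finally show ?thesis by (simp add: A_def B_def algebra_simps)
  qed
  have "{A - \<bar>B\<bar><..<A + \<bar>B\<bar>} \<subseteq> sumset ?X (N' * M)"
  proof
    fix z assume "z \<in> {A - \<bar>B\<bar><..<A + \<bar>B\<bar>}"
    then have "\<bar>z - A\<bar> \<le> \<bar>B\<bar>" by auto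
    then have "\<bar>(z - A) / B\<bar> \<le> 1" using B by (simp add: abs_divide)
    from tilted[OF this] show "z \<in> sumset ?X (N' * M)" using B by simp
  qed
  then show ?thesis using that[of "A - \<bar>B\<bar>" "A + \<bar>B\<bar>"] B by simp
qed

subsection \<open>Values of real polynomials\<close>

lemma poly_unbounded_above:
  fixes p :: "real poly"
  assumes "degree p \<ge> 1" "lead_coeff p > 0"
  shows "\<exists>x. poly p x > c"
proof -
  have deg: "degree (p + [:- c:]) = degree p"
    using assms by (intro degree_add_eq_left) simp
  have "lead_coeff (p + [:- c:]) = lead_coeff p"
    using assms unfolding deg by (simp add: coeff_eq_0)
  then have "lead_coeff (p + [:- c:]) > 0" using assms by simp
  then obtain x where "poly (p + [:- c:]) x > 0" by (rule poly_pos_far_right)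
  then show ?thesis by auto
qed

lemma poly_unbounded_below:
  fixes p :: "real poly"
  assumes "degree p \<ge> 1" "lead_coeff p < 0"
  shows "\<exists>x. poly p x < c"
  using poly_unbounded_above[of "- p" "- c"] assms by simp

lemma odd_degree_reflect:
  fixes p :: "real poly"
  assumes "odd (degree p)"
  defines "q \<equiv> p \<circ>\<^sub>p [:0, -1:]"
  shows "degree q = degree p" "lead_coeff q = - lead_coeff p" "poly q x = poly p (- x)"
proof -
  show d: "degree q = degree p" by (simp add: q_def degree_pcompose)
  have "lead_coeff q = lead_coeff p * (-1) ^ degree p"
    unfolding q_def by (subst lead_coeff_comp) auto
  then show "lead_coeff q = - lead_coeff p" using assms by simp
qed (simp add: q_def poly_pcompose)

lemma odd_degree_unbounded:
  fixes p :: "real poly"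
  assumes "odd (degree p)"
  shows "\<exists>x. poly p x > c" "\<exists>x. poly p x < c"
proof -
  let ?q = "p \<circ>\<^sub>p [:0, -1:]"
  note q = odd_degree_reflect[OF assms]
  have d: "degree p \<ge> 1" using assms by (cases "degree p") auto
  then have "lead_coeff p \<noteq> 0" by auto
  then consider "lead_coeff p > 0" | "lead_coeff p < 0" by linarith
  then have "(\<exists>x. poly p x > c) \<and> (\<exists>x. poly p x < c)"
  proof cases
    case 1
    then have "\<exists>x. poly ?q x < c" using d q(1,2) by (intro poly_unbounded_below) simp_all
    then show ?thesis using poly_unbounded_above[OF d 1] q(3) by auto
  next
    case 2
    then have "\<exists>x. poly ?q x > c" using d q(1,2) by (intro poly_unbounded_above) simp_all
    then show ?thesis using poly_unbounded_below[OF d 2] q(3) by auto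
  qed
  then show "\<exists>x. poly p x > c" "\<exists>x. poly p x < c" by blast+
qed

text \<open>The midpoint of \<open>u\<close> and \<open>v\<close> is attained at a real point, and
  an open neighbourhood of that point, which contains rationals, is still mapped between
  \<open>u\<close> and \<open>v\<close>.\<close>

lemma poly_value_between:
  fixes p :: "real poly"
  assumes "poly p a \<le> u" "u < v" "v \<le> poly p b"
  obtains x :: rat where "u < poly p (of_rat x)" "poly p (of_rat x) < v"
proof -
  have "\<exists>x. poly p x = (u + v) / 2"
  proof -
    have conn: "connected (range (poly p))"
      by (intro connected_continuous_image continuous_intros connected_UNIV)
    have "(u + v) / 2 \<in> range (poly p)"
      by (rule connectedD_interval[OF conn, of "poly p a" "poly p b"]) (use assms in auto)
    then show ?thesis by auto
  qed
  then obtain z where z: "poly p z = (u + v) / 2" by blast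
  have "open (poly p -` {u<..<v})" by (intro open_vimage continuous_intros)
  moreover have "z \<in> poly p -` {u<..<v}" using z assms(2) by simp
  ultimately obtain e where e: "e > 0" "\<And>y. dist y z < e \<Longrightarrow> y \<in> poly p -` {u<..<v}"
    unfolding open_dist by blast
  obtain x where "z < of_rat x" "of_rat x < z + e"
    using of_rat_dense[of z "z + e"] e(1) by auto
  then have "of_rat x \<in> poly p -` {u<..<v}" by (intro e(2)) (simp add: dist_real_def)
  then show ?thesis using that[of x] by simp
qed

lemma poly_map_of_rat: "poly (map_poly of_rat f) (of_rat x :: real) = of_rat (poly f x)"
  by (induction f) (simp_all add: map_poly_pCons of_rat_add of_rat_mult)

text \<open>One more summand f(x) suffices if s - f(x) lies in the interval, that is, if f(x) falls
  strictly between s - \<beta> and s - \<alpha>.\<close>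

lemma mem_sumset_Suc:
  fixes f :: "rat poly"
  assumes ab: "\<alpha> < \<beta>" and sub: "{\<alpha><..<\<beta>} \<subseteq> sumset (range (poly f)) M"
    and lo: "poly (map_poly of_rat f) a \<le> (of_rat (s - \<beta>) :: real)"
    and hi: "(of_rat (s - \<alpha>) :: real) \<le> poly (map_poly of_rat f) b"
  shows "s \<in> sumset (range (poly f)) (Suc M)"
proof -
  have "(of_rat (s - \<beta>) :: real) < of_rat (s - \<alpha>)" using ab by (simp add: of_rat_less)
  from poly_value_between[OF lo this hi] obtain x where
    "(of_rat (s - \<beta>) :: real) < poly (map_poly of_rat f) (of_rat x)"
    "poly (map_poly of_rat f) (of_rat x) < (of_rat (s - \<alpha>) :: real)" by blast
  then have "s - \<beta> < poly f x" "poly f x < s - \<alpha>"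
    by (simp_all add: poly_map_of_rat of_rat_less)
  then have "s - poly f x \<in> sumset (range (poly f)) M" using sub by auto
  then show ?thesis unfolding sumset_Suc by force
qed

theorem theorem4p1:
  fixes f :: "rat poly"
  assumes "degree f \<ge> 1"
  shows "(odd (degree f) \<longrightarrow> WP f)
       \<and> (even (degree f) \<and> lead_coeff f > 0 \<longrightarrow> is_positive_base (range (poly f)))
       \<and> (even (degree f) \<and> lead_coeff f < 0 \<longrightarrow> is_negative_base (range (poly f)))"
proof -
  obtain M \<alpha> \<beta> where ab: "\<alpha> < \<beta>" and sub: "{\<alpha><..<\<beta>} \<subseteq> sumset (range (poly f)) M"
    using sumset_contains_interval[OF assms] .
  define p :: "real poly" where "p = map_poly of_rat f"
  have deg: "degree p = degree f" by (simp add: p_def degree_map_poly)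
  have lead: "lead_coeff p = of_rat (lead_coeff f)"
    unfolding deg by (simp add: p_def coeff_map_poly)
  have p0: "poly p 0 = of_rat (poly f 0)" using poly_map_of_rat[of f 0] by (simp add: p_def)
  have mem: "s \<in> sumset (range (poly f)) (Suc M)"
    if "\<exists>a. poly p a \<le> of_rat (s - \<beta>)" "\<exists>b. of_rat (s - \<alpha>) \<le> poly p b" for s
    using mem_sumset_Suc[OF ab sub] that unfolding p_def by blast
  have "WP f" if odd: "odd (degree f)"
  proof -
    have "s \<in> sumset (range (poly f)) (Suc M)" for s
    proof (rule mem)
      have "odd (degree p)" using odd deg by simp
      note unbounded = odd_degree_unbounded[OF this]
      show "\<exists>a. poly p a \<le> of_rat (s - \<beta>)"
        using unbounded(2) by (meson less_imp_le)
      show "\<exists>b. of_rat (s - \<alpha>) \<le> poly p b"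
        using unbounded(1) by (meson less_imp_le)
    qed
    then show ?thesis unfolding WP_def is_base_def by (intro exI[of _ "Suc M"]) auto
  qed
  moreover have "is_positive_base (range (poly f))" if pos: "lead_coeff f > 0"
  proof -
    \<comment> \<open>Beyond this threshold s - \<beta> exceeds f(0), so 0 is the point with a low
      value; unboundedness supplies the high one.\<close>
    have "{poly f 0 + \<beta><..} \<subseteq> sumset (range (poly f)) (Suc M)"
    proof
      fix s assume "s \<in> {poly f 0 + \<beta><..}"
      then have "poly p 0 \<le> of_rat (s - \<beta>)" unfolding p0 of_rat_less_eq by simp
      moreover have "\<exists>b. of_rat (s - \<alpha>) < poly p b"
        using assms pos deg lead by (intro poly_unbounded_above) simp_all
      ultimately show "s \<in> sumset (range (poly f)) (Suc M)"
        using mem by (meson less_imp_le)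
    qed
    then show ?thesis unfolding is_positive_base_def by (intro exI[of _ "Suc M"]) auto
  qed
  moreover have "is_negative_base (range (poly f))" if neg: "lead_coeff f < 0"
  proof -
    \<comment> \<open>Mirror image: s - \<alpha> is below f(0), so 0 is now the point with a high
      value.\<close>
    have "{..<poly f 0 + \<alpha>} \<subseteq> sumset (range (poly f)) (Suc M)"
    proof
      fix s assume "s \<in> {..<poly f 0 + \<alpha>}"
      then have "of_rat (s - \<alpha>) \<le> poly p 0" unfolding p0 of_rat_less_eq by simp
      moreover have "\<exists>a. poly p a < of_rat (s - \<beta>)"
        using assms neg deg lead by (intro poly_unbounded_below) simp_all
      ultimately show "s \<in> sumset (range (poly f)) (Suc M)"
        using mem by (meson less_imp_le)
    qed
    then show ?thesis unfolding is_negative_base_def by (intro exI[of _ "Suc M"]) auto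
  qed
  ultimately show ?thesis by blast
qed

end
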